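(* Let $n\ge1$. Then $$\frac{\det P_n}{\det P_{n-1}}=(-1)^{n-1}a\,x^{n-1}[n]_{t,u}\prod_{i=1}^{n-1}\bigl(1-ax^i[n-i]_{x,y}\bigr),$$ and $$\frac{\det P_n^k}{\det P_n}=a\,x^{\frac{(k-1)(k-2)}2-\frac{n(n-1)}2}\,y^{\frac{(n+1-k)(n+2-k)}2}\,[n+1]_{t,u}\,{n+1\brack k-1}_{x,y}\quad(1\le k\le n),$$ $$\frac{\det P_n^{n+1}}{\det P_n}=a\,y\,[n+1]_{t,u}[n]_{x,y},\qquad \det P_n^{n+2}=0.$$
   Context: $[n]_{p,q}=\frac{p^n-q^n}{p-q}$, $[n]_{p,q}!=\prod_{m=1}^n[m]_{p,q}$, ${n\brack k}_{p,q}=\frac{[n]_{p,q}!}{[k]_{p,q}![n-k]_{p,q}!}$. Let $\mathbb N_n=\frac{(n+1)(n+2)}2$. For $n\ge0$, $M_n$ is the $\mathbb N_n\times\mathbb N_n$ matrix over $\mathbb Z[a,x,y,t,u]$ with rows/columns indexed by pairs $(i,j)$, $1\le j\le i\le n+1$, the pair $(i,j)$ in position $\frac{i(i-1)}2+j$, with entries $M_n[(i,j),(i,j)]=1-ax^{j-1}[i-j]_{x,y}$; $M_n[(i,j),(i,j+1)]=-ax^{j-1}[i-j]_{x,y}$ ($1\le j\le i-1$); $M_n[(i,j),(i+1,j)]=M_n[(i,j),(i+1,j+1)]=-ax^{j-1}y^{i-j}[i]_{t,u}$ ($i\le n$); all other entries $0$. Let $P_n$ be the $(\mathbb N_n-1)\times(\mathbb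 N_n-1)$ matrix obtained from $M_n$ by deleting its last row and first column (so $P_0$ is the empty matrix, $\det P_0=1$). Let $\overline P_n$ be the $(\mathbb N_n-1)\times(n+2)$ submatrix of $M_{n+1}$ formed by rows $1,\dots,\mathbb N_n-1$ and columns $\mathbb N_n+1,\dots,\mathbb N_{n+1}$. For $1\le k\le n+2$, $P_n^k$ is the matrix obtained from $P_n$ by replacing its rightmost column by the $k$-th column of $\overline P_n$. *)

theory Defs
  imports
    "Jordan_Normal_Form.Determinant"
    "HOL-Computational_Algebra.Computational_Algebra"
begin

(* In an integral domain with exact division the quotient below is taken inside the ring, where
   p - q divides p^n - q^n; in a field it is the ordinary quotient. *)
definition pq_num :: "nat \<Rightarrow> 'a::idom_divide \<Rightarrow> 'a \<Rightarrow> 'a" where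
  "pq_num n p q = (p ^ n - q ^ n) div (p - q)"

definition pq_fact :: "nat \<Rightarrow> 'a::idom_divide \<Rightarrow> 'a \<Rightarrow> 'a" where
  "pq_fact n p q = (\<Prod>m = 1..n. pq_num m p q)"

definition pq_binomial :: "nat \<Rightarrow> nat \<Rightarrow> 'a::idom_divide \<Rightarrow> 'a \<Rightarrow> 'a" where
  "pq_binomial n k p q = pq_fact n p q div (pq_fact k p q * pq_fact (n - k) p q)"

lemma pq_num_sum:
  fixes p q :: "'a::idom_divide"
  assumes "p \<noteq> q"
  shows "pq_num n p q = (\<Sum>i<n. p ^ i * q ^ (n - Suc i))"
proof -
  have "p ^ n - q ^ n = (p - q) * (\<Sum>i<n. q ^ (n - Suc i) * p ^ i)"
    by (rule power_diff_sumr2)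
  then show ?thesis
    using assms by (simp add: pq_num_def mult.commute)
qed

(* The ring Z[a,x,y,t,u], built as Z[a][x][y][t][u]. *)
type_synonym zpoly5 = "int poly poly poly poly poly"

definition var_a :: zpoly5 where "var_a = [:[:[:[:[:0, 1:]:]:]:]:]"
definition var_x :: zpoly5 where "var_x = [:[:[:[:0, 1:]:]:]:]"
definition var_y :: zpoly5 where "var_y = [:[:[:0, 1:]:]:]"
definition var_t :: zpoly5 where "var_t = [:[:0, 1:]:]"
definition var_u :: zpoly5 where "var_u = [:0, 1:]"

definition NN :: "nat \<Rightarrow> nat" where
  "NN n = (n + 1) * (n + 2) div 2"

definition index_pairs :: "(nat \<times> nat) set" where
  "index_pairs = {(i, j). 1 \<le> j \<and> j \<le> i}"

definition pair_pos :: "nat \<times> nat \<Rightarrow> nat" where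
  "pair_pos = (\<lambda>(i, j). i * (i - 1) div 2 + j)"

definition pair_at :: "nat \<Rightarrow> nat \<times> nat" where
  "pair_at = the_inv_into index_pairs pair_pos"

lemma triangle_Suc: "Suc i * (Suc i - 1) div 2 = i * (i - 1) div 2 + i"
proof -
  have "Suc i * (Suc i - 1) = i * (i - 1) + 2 * i"
    by (cases i) simp_all
  then show ?thesis by simp
qed

lemma triangle_mono: "i \<le> k \<Longrightarrow> i * (i - 1) div 2 \<le> k * (k - 1) div (2::nat)"
  by (intro div_le_mono mult_le_mono) auto

lemma inj_on_pair_pos: "inj_on pair_pos index_pairs"
proof -
  have less: "i * (i - 1) div 2 + j < k * (k - 1) div 2 + l"
    if "j \<le> i" "1 \<le> l" "i < k" for i j k l :: nat
    using triangle_mono[of "Suc i" k] that by (simp only: triangle_Suc) linarith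
  show ?thesis
  proof (rule inj_onI, clarify)
    fix i j k l
    assume "(i, j) \<in> index_pairs" "(k, l) \<in> index_pairs" "pair_pos (i, j) = pair_pos (k, l)"
    then have *: "1 \<le> j" "j \<le> i" "1 \<le> l" "l \<le> k"
      "i * (i - 1) div 2 + j = k * (k - 1) div 2 + l"
      by (auto simp: index_pairs_def pair_pos_def)
    then have "i = k"
      using less[of j i l k] less[of l k j i] by (metis linorder_neqE_nat less_irrefl)
    with * show "i = k \<and> j = l" by simp
  qed
qed

lemma pair_pos_image: "pair_pos ` {(i, j). 1 \<le> j \<and> j \<le> i \<and> i \<le> n + 1} = {1..NN n}"
proof (induction n)
  case 0
  have "{(i, j). 1 \<le> j \<and> j \<le> i \<and> i \<le> 0 + 1} = {(1, 1 :: nat)}" by auto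
  then show ?case by (simp add: pair_pos_def NN_def)
next
  case (Suc n)
  have tri: "(n + 2) * (n + 1) div 2 = NN n" by (simp add: NN_def mult.commute)
  have NN_Suc: "NN (Suc n) = NN n + (n + 2)"
    using triangle_Suc[of "n + 2"] by (simp add: NN_def mult.commute)
  have split: "{(i, j). 1 \<le> j \<and> j \<le> i \<and> i \<le> Suc n + 1} =
      {(i, j). 1 \<le> j \<and> j \<le> i \<and> i \<le> n + 1} \<union> Pair (n + 2) ` {1..n + 2}"
    by (auto simp: le_Suc_eq)
  have "pair_pos ` Pair (n + 2) ` {1..n + 2} = (\<lambda>j. NN n + j) ` {1..n + 2}"
    using tri by (auto simp: pair_pos_def image_image)
  also have "\<dots> = {NN n + 1..NN n + (n + 2)}"
    by (subst image_add_atLeastAtMost) (simp add: ac_simps)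
  finally have "pair_pos ` {(i, j). 1 \<le> j \<and> j \<le> i \<and> i \<le> Suc n + 1} =
      {1..NN n} \<union> {NN n + 1..NN n + (n + 2)}"
    by (simp only: split image_Un Suc.IH)
  then show ?case by (auto simp: NN_Suc)
qed

lemma pair_at_pair_pos: "1 \<le> j \<Longrightarrow> j \<le> i \<Longrightarrow> pair_at (pair_pos (i, j)) = (i, j)"
  unfolding pair_at_def
  by (rule the_inv_into_f_f[OF inj_on_pair_pos]) (simp add: index_pairs_def)

(* The ranges j \<le> i - 1 and i \<le> n of the off-diagonal entries need no mention: the column indices
   (i, j + 1), (i + 1, j) and (i + 1, j + 1) occur in the matrix M_n exactly in these ranges. *)
definition M_entry :: "nat \<times> nat \<Rightarrow> nat \<times> nat \<Rightarrow> zpoly5" where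
  "M_entry = (\<lambda>(i, j) c.
     if c = (i, j) then 1 - var_a * var_x ^ (j - 1) * pq_num (i - j) var_x var_y
     else if c = (i, j + 1) then - var_a * var_x ^ (j - 1) * pq_num (i - j) var_x var_y
     else if c = (i + 1, j) \<or> c = (i + 1, j + 1)
       then - var_a * var_x ^ (j - 1) * var_y ^ (i - j) * pq_num i var_t var_u
     else 0)"

(* Rows and columns of matrices are counted from 0, positions of pairs from 1. *)
definition M_mat :: "nat \<Rightarrow> zpoly5 mat" where
  "M_mat n = mat (NN n) (NN n) (\<lambda>(r, c). M_entry (pair_at (r + 1)) (pair_at (c + 1)))"

definition P_mat :: "nat \<Rightarrow> zpoly5 mat" where
  "P_mat n = mat_delete (M_mat n) (NN n - 1) 0"

definition P_bar :: "nat \<Rightarrow> zpoly5 mat" where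
  "P_bar n = mat (NN n - 1) (n + 2) (\<lambda>(r, c). M_mat (n + 1) $$ (r, NN n + c))"

(* k is counted from 1. *)
definition P_rep :: "nat \<Rightarrow> nat \<Rightarrow> zpoly5 mat" where
  "P_rep n k = replace_col (P_mat n) (col (P_bar n) (k - 1)) (dim_col (P_mat n) - 1)"

end

theory Submission
  imports Defs
begin

text \<open>
  The matrix \<open>M\<^sub>n\<close> is upper triangular, so its determinant is the product of its diagonal, and the
  first row \<open>w\<close> of its inverse over the fraction field does not depend on \<open>n\<close>. This row has a closed
  form: \<open>w(m+1, j+1) = C\<^sub>m * r(m, j)\<close> with
  \<open>r(m, j) = x^(j choose 2) / x^(m choose 2) * y^((m-j) choose 2) * [m choose j]\<close> and
  \<open>C\<^sub>m = C\<^sub>m\<^sub>-\<^sub>1 * a * x^(m-1) * [m]\<^sub>t\<^sub>u / (1 - a [m]\<^sub>x\<^sub>y)\<close>; the recurrence expressing \<open>w M = e\<^sub>1\<close>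
  reduces to the Pascal rule and the ratio rule for \<open>(x, y)\<close>-binomials.
  Since \<open>P\<^sub>n\<close> is \<open>M\<^sub>n\<close> without its last row and first column, \<open>det P\<^sub>n\<close> is up to sign the cofactor
  \<open>C\<^sub>n * det M\<^sub>n\<close>. The truncated row \<open>w\<close> annihilates all columns of \<open>P\<^sub>n\<close> but the last, where it gives
  \<open>-C\<^sub>n\<close>, so replacing the last column by \<open>b\<close> multiplies \<open>det P\<^sub>n\<close> by \<open>-(w b) / C\<^sub>n\<close>.
\<close>

section \<open>Arithmetic of (p,q)-numbers and factorials over a field\<close>

lemma pq_num_0 [simp]: "pq_num 0 p q = 0"
  by (simp add: pq_num_def)

lemma pq_num_1:
  fixes p q :: "'a::field"
  assumes "p \<noteq> q"
  shows "pq_num (Suc 0) p q = 1"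
  using assms by (simp add: pq_num_def)

text \<open>Adding and subtracting \<open>p ^ m * q ^ n\<close> splits the difference of powers. The
  Pascal rule rests on this.\<close>

lemma pq_num_add:
  fixes p q :: "'a::field"
  shows "pq_num (m + n) p q = p ^ m * pq_num n p q + q ^ n * pq_num m p q"
proof -
  have "p ^ (m + n) - q ^ (m + n) = p ^ m * (p ^ n - q ^ n) + q ^ n * (p ^ m - q ^ m)"
    by (simp add: algebra_simps power_add)
  then show ?thesis
    by (simp add: pq_num_def add_divide_distrib)
qed

lemma pq_fact_0 [simp]: "pq_fact 0 p q = 1"
  by (simp add: pq_fact_def)

lemma pq_fact_Suc: "pq_fact (Suc n) p q = pq_num (Suc n) p q * pq_fact n p q"
  by (simp add: pq_fact_def)

text \<open>The index set of the rows and columns of \<open>M_mat n\<close>.\<close>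

definition pairs :: "nat \<Rightarrow> (nat \<times> nat) set" where
  "pairs n = {(i, j). 1 \<le> j \<and> j \<le> i \<and> i \<le> n + 1}"

lemma finite_pairs: "finite (pairs n)"
  by (rule finite_subset[of _ "{..n + 1} \<times> {..n + 1}"]) (auto simp: pairs_def)

text \<open>The sequence \<open>\<tau>\<close> stands for \<open>[i]\<^sub>t\<^sub>u\<close>.\<close>
locale pq_weights =
  fixes a x y :: "'a::field" and \<tau> :: "nat \<Rightarrow> 'a"
  assumes x_nonzero: "x \<noteq> 0"
    and x_neq_y: "x \<noteq> y"
    and pq_num_nonzero: "0 < m \<Longrightarrow> pq_num m x y \<noteq> 0"
    and diag_nonzero: "1 - a * x ^ i * pq_num j x y \<noteq> 0"
begin

abbreviation num :: "nat \<Rightarrow> 'a" where "num n \<equiv> pq_num n x y"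

section \<open>Rules for (x,y)-binomials\<close>

lemma pq_fact_nonzero: "pq_fact n x y \<noteq> 0"
  by (induction n) (simp_all add: pq_fact_Suc pq_num_nonzero)

lemma pq_binomial_0: "pq_binomial n 0 x y = 1"
  by (simp add: pq_binomial_def pq_fact_nonzero)

lemma pq_binomial_self: "pq_binomial n n x y = 1"
  by (simp add: pq_binomial_def pq_fact_nonzero)

text \<open>Both sides equal [n]! / ([k]! [n-k-1]!).\<close>

lemma pq_binomial_Suc_mult:
  assumes "k < n"
  shows "pq_binomial n (Suc k) x y * num (Suc k) = pq_binomial n k x y * num (n - k)"
proof -
  obtain d where n: "n = Suc k + d"
    using assms less_iff_Suc_add by auto
  show ?thesis
    using pq_fact_nonzero[of k] pq_fact_nonzero[of d]
      pq_num_nonzero[of "Suc k"] pq_num_nonzero[of "Suc d"]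
    by (simp add: n pq_binomial_def pq_fact_Suc Suc_diff_le field_simps)
qed

text \<open>Split [n+1] = x^(k+1) [n-k] + y^(n-k) [k+1] in the numerator; each summand cancels one
  factor of the denominator.\<close>

lemma pq_binomial_Suc_Suc:
  assumes "k < n"
  shows "pq_binomial (Suc n) (Suc k) x y =
    x ^ Suc k * pq_binomial n (Suc k) x y + y ^ (n - k) * pq_binomial n k x y"
proof -
  obtain d where n: "n = Suc k + d"
    using assms less_iff_Suc_add by auto
  define Fk Fd Fn Nk Nd where F: "Fk = pq_fact k x y" "Fd = pq_fact d x y" "Fn = pq_fact n x y"
    "Nk = num (Suc k)" "Nd = num (Suc d)"
  have nz: "Fk \<noteq> 0" "Fd \<noteq> 0" "Nk \<noteq> 0" "Nd \<noteq> 0"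
    by (simp_all add: F pq_fact_nonzero pq_num_nonzero)
  have "num (Suc n) = x ^ Suc k * Nd + y ^ Suc d * Nk"
    using pq_num_add[of "Suc k" "Suc d" x y] by (simp add: n F)
  then have "pq_binomial (Suc n) (Suc k) x y =
      (x ^ Suc k * Nd + y ^ Suc d * Nk) * Fn / (Nk * Fk * (Nd * Fd))"
    by (simp add: pq_binomial_def pq_fact_Suc F n Suc_diff_le)
  moreover have "pq_binomial n (Suc k) x y = Fn / (Nk * Fk * Fd)"
    by (simp add: pq_binomial_def pq_fact_Suc F n)
  moreover have "pq_binomial n k x y = Fn / (Fk * (Nd * Fd))"
    by (simp add: pq_binomial_def pq_fact_Suc F n Suc_diff_le)
  moreover have "n - k = Suc d"
    by (simp add: n)
  moreover have "(x ^ Suc k * Nd + y ^ Suc d * Nk) * Fn / (Nk * Fk * (Nd * Fd)) =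
      x ^ Suc k * (Fn / (Nk * Fk * Fd)) + y ^ Suc d * (Fn / (Fk * (Nd * Fd)))"
    using nz by (simp add: field_simps)
  ultimately show ?thesis
    by simp
qed

section \<open>Closed form of the row w\<close>

text \<open>An entry of w divided by the last entry of its block. The value 0 for
  \<open>j > m\<close> lets the rules below hold at the edge of the triangle.\<close>

definition ratio :: "nat \<Rightarrow> nat \<Rightarrow> 'a" where
  "ratio m j = (if j \<le> m then
     x ^ (j choose 2) / x ^ (m choose 2) * y ^ ((m - j) choose 2) * pq_binomial m j x y else 0)"

lemma Suc_choose_2: "Suc n choose 2 = (n choose 2) + n"
  by (simp add: numeral_2_eq_2)

lemma ratio_self: "ratio m m = 1"
  using x_nonzero by (simp add: ratio_def pq_binomial_self binomial_eq_0)

lemma ratio_0: "ratio m 0 = y ^ (m choose 2) / x ^ (m choose 2)"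
  by (simp add: ratio_def pq_binomial_0 binomial_eq_0)

text \<open>The powers of x and y are the increments of the exponents (j choose 2) and ((m-j) choose
  2), which leaves the ratio rule for binomials. For \<open>j \<ge> m\<close> both sides
  vanish.\<close>

lemma ratio_Suc_mult:
  "y ^ (m - Suc j) * num (Suc j) * ratio m (Suc j) = x ^ j * num (m - j) * ratio m j"
proof (cases "j < m")
  case True
  then obtain d where m: "m = Suc j + d"
    using less_iff_Suc_add by auto
  have "pq_binomial m (Suc j) x y * num (Suc j) = pq_binomial m j x y * num (Suc d)"
    using pq_binomial_Suc_mult[OF True] by (simp add: m Suc_diff_le)
  then show ?thesis
    using x_nonzero
    by (simp add: ratio_def m Suc_diff_le Suc_choose_2 power_add field_simps)
qed (auto simp: ratio_def)

text \<open>The powers in front bring both terms to a common monomial, and the Pascal rule adds what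
  remains. For \<open>j = m\<close> only the second term survives.\<close>

lemma ratio_pascal:
  assumes "j \<le> m"
  shows "x ^ Suc j * y ^ (m - Suc j) * ratio m (Suc j) + x ^ j * y ^ (m - j) * ratio m j =
    x ^ (Suc j choose 2) / x ^ (m choose 2) * y ^ ((m - j) choose 2) * pq_binomial (Suc m) (Suc j) x y"
proof (cases "j = m")
  case True
  then show ?thesis
    using x_nonzero
    by (simp add: ratio_def pq_binomial_self Suc_choose_2 binomial_eq_0 power_add)
next
  case False
  then have "j < m"
    using assms by simp
  then obtain d where m: "m = Suc j + d"
    using less_iff_Suc_add by auto
  have "pq_binomial (Suc m) (Suc j) x y =
      x ^ Suc j * pq_binomial m (Suc j) x y + y ^ Suc d * pq_binomial m j x y"
    using pq_binomial_Suc_Suc[of j m] by (simp add: m Suc_diff_le)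
  then show ?thesis
    using x_nonzero
    by (simp add: ratio_def m Suc_diff_le Suc_choose_2 power_add field_simps)
qed

text \<open>The entry of w at (m+1, m+1). Its factor comes from column (m+2, 1) of w M =
  e_1.\<close>

fun corner :: "nat \<Rightarrow> 'a" where
  "corner 0 = 1"
| "corner (Suc m) = corner m * (a * \<tau> (Suc m) * x ^ m / (1 - a * num (Suc m)))"

lemma corner_Suc_mult: "corner (Suc m) * (1 - a * num (Suc m)) = a * \<tau> (Suc m) * x ^ m * corner m"
  using diag_nonzero[of 0 "Suc m"] by simp

text \<open>The row w, indexed from 1. It is 0 outside the triangle, so that column equations need
  no boundary cases.\<close>

definition weight :: "nat \<times> nat \<Rightarrow> 'a" where
  "weight = (\<lambda>(i, j). if 1 \<le> j \<and> j \<le> i then corner (i - 1) * ratio (i - 1) (j - 1) else 0)"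

definition entry :: "nat \<times> nat \<Rightarrow> nat \<times> nat \<Rightarrow> 'a" where
  "entry = (\<lambda>(i, j) c.
     if c = (i, j) then 1 - a * x ^ (j - 1) * num (i - j)
     else if c = (i, j + 1) then - a * x ^ (j - 1) * num (i - j)
     else if c = (i + 1, j) \<or> c = (i + 1, j + 1) then - a * x ^ (j - 1) * y ^ (i - j) * \<tau> i
     else 0)"

text \<open>In column (i+1, j+1) only the rows (i+1, j+1), (i+1, j), (i, j+1) and (i, j) can be
  nonzero. Letting \<open>v\<close> vanish at rows missing from \<open>S\<close> makes one formula
  serve boundary columns and truncated rows alike.\<close>

lemma sum_mult_entry:
  assumes "finite S"
    and "\<And>p. p \<in> {(Suc i, Suc j), (Suc i, j), (i, Suc j), (i, j)} - S \<Longrightarrow> v p = 0"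
  shows "(\<Sum>p\<in>S. v p * entry p (Suc i, Suc j)) =
    v (Suc i, Suc j) * (1 - a * x ^ j * num (i - j)) - a * x ^ (j - 1) * num (Suc i - j) * v (Suc i, j)
    - a * \<tau> i * (x ^ j * y ^ (i - Suc j) * v (i, Suc j) + x ^ (j - 1) * y ^ (i - j) * v (i, j))"
proof -
  let ?T = "{(Suc i, Suc j), (Suc i, j), (i, Suc j), (i, j)}"
  have zero: "entry p (Suc i, Suc j) = 0" if "p \<notin> ?T" for p
    using that by (cases p) (auto simp: entry_def)
  have "(\<Sum>p\<in>S. v p * entry p (Suc i, Suc j)) = (\<Sum>p\<in>?T. v p * entry p (Suc i, Suc j))"
  proof (rule sum.mono_neutral_cong)
    show "v p * entry p (Suc i, Suc j) = 0" if "p \<in> ?T - S" for p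
      using assms(2)[OF that] by simp
    show "v p * entry p (Suc i, Suc j) = 0" if "p \<in> S - ?T" for p
      using zero[of p] that by simp
  qed (use assms(1) in simp_all)
  then show ?thesis
    by (simp add: entry_def algebra_simps)
qed

text \<open>This is column (m+2, j+1) of w M = e_1. Pascal collects the two terms from the block
  above into a multiple of 1 - a [m+1]; splitting [m+1] then separates the diagonal term from the
  one of the left neighbour.\<close>

lemma weight_recurrence:
  assumes "j \<le> Suc m"
  shows "weight (Suc (Suc m), Suc j) * (1 - a * x ^ j * num (Suc m - j)) =
    a * x ^ (j - 1) * num (Suc (Suc m) - j) * weight (Suc (Suc m), j)
    + a * \<tau> (Suc m) * (x ^ j * y ^ (Suc m - Suc j) * weight (Suc m, Suc j)
       + x ^ (j - 1) * y ^ (Suc m - j) * weight (Suc m, j))"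
proof (cases j)
  case 0
  \<comment> \<open>In the first column of a block the weights at (m+2, 0) and (m+1, 0) are 0, so
    one term from above must match the diagonal term.\<close>
  have "y ^ m * ratio m 0 = x ^ m * ratio (Suc m) 0"
    using x_nonzero by (simp add: ratio_0 Suc_choose_2 power_add field_simps)
  then have "a * \<tau> (Suc m) * (y ^ m * (corner m * ratio m 0)) =
      a * \<tau> (Suc m) * x ^ m * corner m * ratio (Suc m) 0"
    by (simp add: ac_simps)
  then show ?thesis
    by (simp add: weight_def 0 corner_Suc_mult[symmetric] del: corner.simps)
next
  case (Suc l)
  have l: "l \<le> m"
    using assms Suc by simp
  define C where "C = corner (Suc m)"
  \<comment> \<open>Passing from (m choose 2) to (m+1 choose 2) in the denominator costs the factor
    x^m.\<close>
  have pascal: "x ^ Suc l * y ^ (m - Suc l) * ratio m (Suc l) + x ^ l * y ^ (m - l) * ratio m l =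
      x ^ m * ratio (Suc m) (Suc l)"
    using ratio_pascal[OF l] l x_nonzero by (simp add: ratio_def Suc_choose_2 power_add)
  have split: "num (Suc m) = x ^ Suc l * num (m - l) + y ^ (m - l) * num (Suc l)"
    using pq_num_add[of "Suc l" "m - l" x y] l by simp
  have step: "y ^ (m - l) * num (Suc l) * ratio (Suc m) (Suc l) =
      x ^ l * num (Suc m - l) * ratio (Suc m) l"
    using ratio_Suc_mult[of "Suc m" l] by simp
  have "a * \<tau> (Suc m) * (x ^ Suc l * y ^ (m - Suc l) * (corner m * ratio m (Suc l))
       + x ^ l * y ^ (m - l) * (corner m * ratio m l)) =
      a * \<tau> (Suc m) * corner m *
       (x ^ Suc l * y ^ (m - Suc l) * ratio m (Suc l) + x ^ l * y ^ (m - l) * ratio m l)"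
    by (simp add: algebra_simps)
  also have "\<dots> = C * (1 - a * num (Suc m)) * ratio (Suc m) (Suc l)"
    unfolding pascal C_def corner_Suc_mult by (simp add: algebra_simps)
  also have "\<dots> = C * ratio (Suc m) (Suc l) * (1 - a * x ^ Suc l * num (m - l))
      - a * C * (y ^ (m - l) * num (Suc l) * ratio (Suc m) (Suc l))"
    unfolding split by (simp add: algebra_simps)
  also have "\<dots> = C * ratio (Suc m) (Suc l) * (1 - a * x ^ Suc l * num (m - l))
      - a * x ^ l * num (Suc m - l) * (C * ratio (Suc m) l)"
    unfolding step by (simp add: algebra_simps)
  finally have *: "C * ratio (Suc m) (Suc l) * (1 - a * x ^ Suc l * num (m - l)) =
      a * x ^ l * num (Suc m - l) * (C * ratio (Suc m) l)
      + a * \<tau> (Suc m) * (x ^ Suc l * y ^ (m - Suc l) * (corner m * ratio m (Suc l))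
       + x ^ l * y ^ (m - l) * (corner m * ratio m l))"
    by (simp add: algebra_simps)
  \<comment> \<open>For \<open>l = m\<close> the index of the third weight lies outside the
    triangle, in agreement with \<open>ratio m (Suc m) = 0\<close>.\<close>
  have w: "weight (Suc (Suc m), Suc j) = C * ratio (Suc m) (Suc l)"
    "weight (Suc (Suc m), j) = C * ratio (Suc m) l"
    "weight (Suc m, Suc j) = corner m * ratio m (Suc l)"
    "weight (Suc m, j) = corner m * ratio m l"
    using l by (auto simp: weight_def Suc C_def ratio_def simp del: corner.simps)
  show ?thesis
    unfolding w using * by (simp add: Suc del: power_Suc)
qed

lemma weight_outside: "\<not> (1 \<le> j \<and> j \<le> i) \<Longrightarrow> weight (i, j) = 0"
  by (auto simp: weight_def)

lemma sum_weight_entry: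
  assumes "c \<in> pairs n"
  shows "(\<Sum>p\<in>pairs n. weight p * entry p c) = (if c = (1, 1) then 1 else 0)"
proof -
  obtain i j where c: "c = (Suc i, Suc j)" "j \<le> i" "i \<le> n"
    using assms by (cases c; cases "fst c"; cases "snd c") (auto simp: pairs_def)
  have "(\<Sum>p\<in>pairs n. weight p * entry p (Suc i, Suc j)) =
    weight (Suc i, Suc j) * (1 - a * x ^ j * num (i - j))
    - a * x ^ (j - 1) * num (Suc i - j) * weight (Suc i, j)
    - a * \<tau> i * (x ^ j * y ^ (i - Suc j) * weight (i, Suc j) + x ^ (j - 1) * y ^ (i - j) * weight (i, j))"
    using c by (intro sum_mult_entry finite_pairs) (auto simp: pairs_def intro!: weight_outside)
  also have "\<dots> = (if c = (1, 1) then 1 else 0)"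
  proof (cases i)
    case 0
    then show ?thesis
      using c by (simp add: weight_def ratio_self)
  next
    case (Suc m)
    then show ?thesis
      using c weight_recurrence[of j m] by (simp add: algebra_simps)
  qed
  finally show ?thesis
    by (simp add: c)
qed

section \<open>The truncated row w applied to the next block of columns\<close>

text \<open>The product of w, without its last entry, and the \<open>k\<close>-th column of
  \<open>P_bar n\<close>. The pair (n+1, n+1) is left out because \<open>P_mat n\<close> lacks the
  last row.\<close>

definition border :: "nat \<Rightarrow> nat \<Rightarrow> 'a" where
  "border n k = (\<Sum>p\<in>pairs n - {(n + 1, n + 1)}. weight p * entry p (n + 2, k))"

text \<open>The rows of block n+2 are absent, so only the two terms from block n+1 remain.\<close>

lemma border_eq:
  defines "v n p \<equiv> if p \<in> pairs n - {(n + 1, n + 1)} then weight p else 0"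
  shows "border n (Suc j) = - a * \<tau> (n + 1) *
    (x ^ j * y ^ (n - j) * v n (n + 1, Suc j) + x ^ (j - 1) * y ^ (n + 1 - j) * v n (n + 1, j))"
proof -
  have "border n (Suc j) = (\<Sum>p\<in>pairs n - {(n + 1, n + 1)}. v n p * entry p (Suc (n + 1), Suc j))"
    unfolding border_def by (intro sum.cong) (auto simp: v_def)
  also have "\<dots> = - a * \<tau> (n + 1) *
    (x ^ j * y ^ (n - j) * v n (n + 1, Suc j) + x ^ (j - 1) * y ^ (n + 1 - j) * v n (n + 1, j))"
    using finite_pairs[of n] by (subst sum_mult_entry) (auto simp: v_def, auto simp: pairs_def)
  finally show ?thesis .
qed

text \<open>For \<open>k \<le> n\<close> neither of the two terms meets the omitted pair (n+1, n+1),
  so \<open>ratio_pascal\<close> applies; for \<open>k = 1\<close> there is just one term.\<close>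

lemma border_le:
  assumes "1 \<le> k" "k \<le> n"
  shows "border n k = - a * \<tau> (n + 1) * corner n *
    (x ^ ((k - 1) choose 2) / x ^ (n choose 2) * y ^ ((n + 2 - k) choose 2) *
      pq_binomial (n + 1) (k - 1) x y)"
proof (cases "k = 1")
  case True
  have "border n 1 = - a * \<tau> (n + 1) * (y ^ n * (corner n * ratio n 0))"
    using assms border_eq[of n 0] True by (simp add: pairs_def weight_def)
  then show ?thesis
    by (simp add: True ratio_0 pq_binomial_0 Suc_choose_2 power_add binomial_eq_0)
next
  case False
  then obtain j where k: "k = Suc (Suc j)"
    using assms by (cases k; cases "k - 1") auto
  have "border n k = - a * \<tau> (n + 1) * corner n *
      (x ^ Suc j * y ^ (n - Suc j) * ratio n (Suc j) + x ^ j * y ^ (n - j) * ratio n j)"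
    using assms border_eq[of n "Suc j"] by (simp add: k pairs_def weight_def algebra_simps)
  then show ?thesis
    using assms by (subst (asm) ratio_pascal) (simp_all add: k)
qed

text \<open>The term of (n+1, n+1) is omitted, and the one of (n+1, n) is evaluated by the ratio
  rule next to the diagonal.\<close>

lemma border_Suc:
  assumes "1 \<le> n"
  shows "border n (n + 1) = - a * \<tau> (n + 1) * corner n * (y * num n)"
proof -
  obtain m where n: "n = Suc m"
    using assms by (cases n) auto
  have "x ^ m * ratio n m = num n"
    using ratio_Suc_mult[of n m] pq_num_1[OF x_neq_y] by (simp add: n ratio_self)
  moreover have "border n (n + 1) = - a * \<tau> (n + 1) * (x ^ m * y * (corner n * ratio n m))"
    using border_eq[of n n] by (simp add: n pairs_def weight_def del: corner.simps)
  ultimately show ?thesis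
    by (simp add: ac_simps)
qed

text \<open>One of the two pairs is the omitted one, the other lies outside the triangle.\<close>

lemma border_Suc_Suc: "border n (n + 2) = 0"
  using border_eq[of n "n + 1"] by (simp add: pairs_def)

lemma corner_nonzero:
  assumes "a \<noteq> 0" "\<And>i. 0 < i \<Longrightarrow> \<tau> i \<noteq> 0"
  shows "corner m \<noteq> 0"
  using assms x_nonzero diag_nonzero[of 0] by (induction m) simp_all

end

section \<open>Enumeration of the pairs by matrix indices\<close>

lemma NN_pos: "0 < NN n"
  by (simp add: NN_def)

lemma pair_pos_Suc_le: "j \<le> n + 2 \<Longrightarrow> pair_pos (n + 2, j) = NN n + j"
  by (simp add: pair_pos_def NN_def mult.commute)

lemma pair_pos_corner: "pair_pos (n + 1, n + 1) = NN n"
  using triangle_Suc[of "n + 1"] by (simp add: pair_pos_def NN_def mult.commute)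

lemma NN_Suc: "NN (Suc n) = NN n + (n + 2)"
  using pair_pos_Suc_le[of "n + 2" n] pair_pos_corner[of "n + 1"] by simp

lemma bij_betw_pair_at: "bij_betw (\<lambda>r. pair_at (Suc r)) {..<NN n} (pairs n)"
proof -
  have "bij_betw pair_at (pair_pos ` pairs n) (pairs n)"
    by (rule bij_betw_byWitness[where f' = pair_pos]) (auto simp: pairs_def pair_at_pair_pos)
  then have "bij_betw pair_at {1..NN n} (pairs n)"
    by (simp only: pairs_def pair_pos_image)
  moreover have "bij_betw Suc {..<NN n} {1..NN n}"
    by (simp add: bij_betw_def image_Suc_lessThan)
  ultimately show ?thesis
    using bij_betw_trans[of Suc "{..<NN n}" "{1..NN n}" pair_at "pairs n"] by (simp add: comp_def)
qed

lemma sum_pair_at: "(\<Sum>r<NN n. f (pair_at (Suc r))) = (\<Sum>p\<in>pairs n. f p)"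
  using sum.reindex_bij_betw[OF bij_betw_pair_at] .

lemma pair_at_NN: "pair_at (NN n) = (n + 1, n + 1)"
  using pair_at_pair_pos[of "n + 1" "n + 1"] by (simp only: pair_pos_corner)

lemma sum_pair_at_butlast:
  fixes f :: "nat \<times> nat \<Rightarrow> 'a::ab_group_add"
  shows "(\<Sum>r<NN n - 1. f (pair_at (Suc r))) = (\<Sum>p\<in>pairs n - {(n + 1, n + 1)}. f p)"
proof -
  obtain N where N: "NN n = Suc N"
    using NN_pos gr0_implies_Suc by blast
  have "pair_at (Suc N) = (n + 1, n + 1)"
    using pair_at_NN[of n] by (simp add: N)
  moreover have "(n + 1, n + 1) \<in> pairs n"
    by (simp add: pairs_def)
  ultimately show ?thesis
    using sum_pair_at[of f n] by (simp add: N sum_diff1 finite_pairs eq_diff_eq)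
qed

section \<open>Cofactors from row relations and replaced columns\<close>

text \<open>Multiply w A = d e_l by the adjugate of A from the right and compare entries at index r.
  No division by det A occurs.\<close>

lemma cofactor_from_row_combination:
  fixes A :: "'a::comm_ring_1 mat"
  assumes A: "A \<in> carrier_mat N N" and "r < N" "l < N"
    and comb: "\<And>c. c < N \<Longrightarrow> (\<Sum>r<N. w r * A $$ (r, c)) = (if c = l then d else 0)"
  shows "d * cofactor A r l = w r * det A"
proof -
  \<comment> \<open>This is A adj(A) = det(A) I, read entrywise.\<close>
  have prod: "(\<Sum>c<N. A $$ (s, c) * cofactor A r c) = (if s = r then det A else 0)" if "s < N" for s
  proof -
    have "(\<Sum>c<N. A $$ (s, c) * cofactor A r c) = (A * adj_mat A) $$ (s, r)"
      using that \<open>r < N\<close> A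
      by (auto simp: times_mat_def scalar_prod_def adj_mat_def intro!: sum.cong)
    also have "\<dots> = (if s = r then det A else 0)"
      using that \<open>r < N\<close> by (simp add: adj_mat(2)[OF A])
    finally show ?thesis .
  qed
  have "d * cofactor A r l = (\<Sum>c<N. (\<Sum>s<N. w s * A $$ (s, c)) * cofactor A r c)"
    using \<open>l < N\<close> by (simp add: comb if_distrib[of "\<lambda>z. z * _"] cong: if_cong)
  also have "\<dots> = (\<Sum>s<N. w s * (\<Sum>c<N. A $$ (s, c) * cofactor A r c))"
    unfolding sum_distrib_left sum_distrib_right by (subst sum.swap) (simp add: mult.assoc)
  also have "\<dots> = w r * det A"
    using \<open>r < N\<close> by (simp add: prod if_distrib cong: if_cong)
  finally show ?thesis .
qed

lemma (in comm_ring_hom) hom_cofactor: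
  assumes "A \<in> carrier_mat N N" "r < N" "l < N"
  shows "cofactor (map_mat hom A) r l = hom (cofactor A r l)"
proof -
  have "mat_delete (map_mat hom A) r l = map_mat hom (mat_delete A r l)"
    using assms by (intro eq_matI) (auto simp: mat_delete_def)
  then show ?thesis
    by (simp add: cofactor_def hom_distribs)
qed

text \<open>Laplace expansion along column \<open>l\<close>, whose minors do not see the
  replacement.\<close>

lemma det_replace_col:
  fixes A :: "'a::comm_ring_1 mat"
  assumes A: "A \<in> carrier_mat N N" and l: "l < N"
  shows "det (replace_col A b l) = (\<Sum>r<N. b $ r * cofactor A r l)"
proof -
  have R: "replace_col A b l \<in> carrier_mat N N"
    using A by (auto simp: replace_col_def)
  have "mat_delete (replace_col A b l) r l = mat_delete A r l" for r
    using A by (intro eq_matI) (auto simp: replace_col_def mat_delete_def)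
  then show ?thesis
    using A l unfolding laplace_expansion_column[OF R l]
    by (auto simp: cofactor_def replace_col_def intro!: sum.cong)
qed

section \<open>Passage from the polynomial ring to its fraction field\<close>

interpretation to_fract_hom: comm_ring_hom to_fract
  by unfold_locales simp_all

text \<open>Evaluation at \<open>a = y = u = 0\<close>, \<open>x = t = 1\<close>, where every denominator specialises to 1.\<close>
definition eval_point :: "zpoly5 \<Rightarrow> int" where
  "eval_point p = poly (poly (poly (poly (poly p 0) 1) 0) 1) 0"

lemma eval_point_simps [simp]:
  "eval_point 0 = 0" "eval_point 1 = 1"
  "eval_point (p - q) = eval_point p - eval_point q"
  "eval_point (p * q) = eval_point p * eval_point q"
  "eval_point (p ^ n) = eval_point p ^ n"
  "eval_point var_a = 0" "eval_point var_x = 1" "eval_point var_y = 0"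
  "eval_point var_t = 1" "eval_point var_u = 0"
  by (simp_all add: eval_point_def var_a_def var_x_def var_y_def var_t_def var_u_def)

lemma eval_point_neqI: "eval_point p \<noteq> eval_point q \<Longrightarrow> p \<noteq> q"
  by auto

text \<open>The geometric sum for [n] is free of division, hence preserved by ring
  homomorphisms.\<close>

lemma to_fract_pq_num:
  assumes "p \<noteq> q"
  shows "to_fract (pq_num n p q) = pq_num n (to_fract p) (to_fract q)"
  using assms by (simp add: pq_num_sum to_fract_hom.hom_sum to_fract_hom.hom_power)

lemma pq_num_to_fract_nonzero:
  assumes "eval_point p = 1" "eval_point q = 0" "0 < n"
  shows "pq_num n (to_fract p) (to_fract q) \<noteq> 0"
proof -
  have "p \<noteq> q" "p ^ n \<noteq> q ^ n"
    by (rule eval_point_neqI; use assms in \<open>simp add: power_0_left\<close>)+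
  then show ?thesis
    by (simp add: pq_num_def flip: to_fract_hom.hom_power)
qed

lemma var_x_neq_y: "var_x \<noteq> var_y"
  by (rule eval_point_neqI) simp

lemma var_t_neq_u: "var_t \<noteq> var_u"
  by (rule eval_point_neqI) simp

interpretation W: pq_weights "to_fract var_a" "to_fract var_x" "to_fract var_y"
  "\<lambda>i. pq_num i (to_fract var_t) (to_fract var_u)"
proof
  show "to_fract var_x \<noteq> 0"
    unfolding to_fract_eq_0_iff by (rule eval_point_neqI) simp
  show "to_fract var_x \<noteq> to_fract var_y"
    by (simp add: var_x_neq_y)
  show "pq_num m (to_fract var_x) (to_fract var_y) \<noteq> 0" if "0 < m" for m
    using that by (simp add: pq_num_to_fract_nonzero)
  fix i j
  have "1 - to_fract var_a * to_fract var_x ^ i * pq_num j (to_fract var_x) (to_fract var_y) =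
      to_fract (1 - var_a * var_x ^ i * pq_num j var_x var_y)"
    by (simp add: to_fract_pq_num var_x_neq_y to_fract_hom.hom_power)
  \<comment> \<open>The variable \<open>var_a\<close> is 0 at the evaluation point, so the left side
    takes the value 1 there.\<close>
  moreover have "1 - var_a * var_x ^ i * pq_num j var_x var_y \<noteq> 0"
    by (rule eval_point_neqI) simp
  ultimately show "1 - to_fract var_a * to_fract var_x ^ i * pq_num j (to_fract var_x) (to_fract var_y) \<noteq> 0"
    by (simp only: to_fract_eq_0_iff not_False_eq_True)
qed

lemma to_fract_M_entry: "to_fract (M_entry p c) = W.entry p c"
  by (cases p) (simp add: M_entry_def W.entry_def to_fract_pq_num var_x_neq_y var_t_neq_u
      to_fract_hom.hom_power)

lemma corner_nonzero: "W.corner m \<noteq> 0"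
proof (rule W.corner_nonzero)
  have "var_a \<noteq> 0"
    by (simp add: var_a_def)
  then show "to_fract var_a \<noteq> 0"
    by simp
qed (simp add: pq_num_to_fract_nonzero)

section \<open>The determinants of M_n and P_n\<close>

lemma M_mat_carrier: "M_mat n \<in> carrier_mat (NN n) (NN n)"
  by (simp add: M_mat_def)

text \<open>The columns (i, j+1), (i+1, j) and (i+1, j+1) never precede (i, j) in the enumeration;
  hence M_n is upper triangular.\<close>

lemma M_entry_eq_0:
  assumes "pair_pos c < pair_pos p"
  shows "M_entry p c = 0"
proof -
  obtain i j where p: "p = (i, j)"
    by (cases p)
  have "pair_pos (i, j) \<le> pair_pos (Suc i, j)" "pair_pos (i, j) \<le> pair_pos (Suc i, Suc j)"
    using triangle_mono[of i "Suc i"] by (simp_all add: pair_pos_def)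
  moreover have "pair_pos (i, j) \<le> pair_pos (i, Suc j)"
    by (simp add: pair_pos_def)
  ultimately show ?thesis
    using assms by (auto simp: p M_entry_def)
qed

lemma pair_pos_pair_at:
  assumes "0 < r" "r \<le> NN n"
  shows "pair_pos (pair_at r) = r"
proof -
  have "r \<in> pair_pos ` pairs n"
    using assms unfolding pairs_def pair_pos_image by simp
  then obtain i j where "r = pair_pos (i, j)" "1 \<le> j" "j \<le> i"
    unfolding pairs_def by blast
  then show ?thesis
    by (simp only: pair_at_pair_pos)
qed

lemma pair_at_in_pairs: "r < NN n \<Longrightarrow> pair_at (Suc r) \<in> pairs n"
  using bij_betwE[OF bij_betw_pair_at] by blast

lemma M_mat_upper: "c < r \<Longrightarrow> r < NN n \<Longrightarrow> M_mat n $$ (r, c) = 0"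
  using pair_pos_pair_at[of "Suc r" n] pair_pos_pair_at[of "Suc c" n]
  by (simp add: M_mat_def M_entry_eq_0)

lemma det_M_mat: "to_fract (det (M_mat n)) = (\<Prod>p\<in>pairs n. W.entry p p)"
proof -
  have "upper_triangular (M_mat n)"
    using M_mat_carrier[of n] by (auto simp: upper_triangular_def M_mat_upper)
  then have "det (M_mat n) = (\<Prod>r<NN n. M_mat n $$ (r, r))"
    using det_upper_triangular[OF _ M_mat_carrier] M_mat_carrier[of n]
    by (simp add: prod_list_diag_prod atLeast0LessThan)
  also have "\<dots> = (\<Prod>r<NN n. M_entry (pair_at (Suc r)) (pair_at (Suc r)))"
    by (simp add: M_mat_def)
  also have "\<dots> = (\<Prod>p\<in>pairs n. M_entry p p)"
    using prod.reindex_bij_betw[OF bij_betw_pair_at] .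
  finally show ?thesis
    by (simp add: to_fract_hom.hom_prod to_fract_M_entry)
qed

lemma det_M_mat_nonzero: "to_fract (det (M_mat n)) \<noteq> 0"
proof -
  have "W.entry p p \<noteq> 0" for p
    by (cases p) (simp only: W.entry_def case_prod_conv simp_thms if_True W.diag_nonzero)
  then show ?thesis
    unfolding det_M_mat by (simp only: prod_zero_iff finite_pairs) blast
qed

lemma pair_at_1: "pair_at (Suc 0) = (1, 1)"
  using pair_at_pair_pos[of 1 1] by (simp add: pair_pos_def)

lemma pair_at_eq_1:
  assumes "c < NN n"
  shows "pair_at (Suc c) = (1, 1) \<longleftrightarrow> c = 0"
proof
  assume "pair_at (Suc c) = (1, 1)"
  moreover have "pair_pos (pair_at (Suc c)) = Suc c"
    using assms by (intro pair_pos_pair_at[of _ n]) simp_all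
  ultimately show "c = 0"
    by (simp add: pair_pos_def)
qed (simp add: pair_at_1)

lemma sum_weight_M_mat:
  assumes "c < NN n"
  shows "(\<Sum>r<NN n. W.weight (pair_at (Suc r)) * to_fract (M_mat n $$ (r, c))) =
    (if c = 0 then 1 else 0)"
proof -
  have "(\<Sum>r<NN n. W.weight (pair_at (Suc r)) * to_fract (M_mat n $$ (r, c))) =
      (\<Sum>r<NN n. W.weight (pair_at (Suc r)) * W.entry (pair_at (Suc r)) (pair_at (Suc c)))"
    using assms by (intro sum.cong refl) (simp add: M_mat_def to_fract_M_entry)
  also have "\<dots> = (\<Sum>p\<in>pairs n. W.weight p * W.entry p (pair_at (Suc c)))"
    by (rule sum_pair_at)
  finally show ?thesis
    using W.sum_weight_entry[OF pair_at_in_pairs[OF assms]] pair_at_eq_1[OF assms] by simp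
qed

lemma weight_corner: "W.weight (n + 1, n + 1) = W.corner n"
  by (simp add: W.weight_def W.ratio_self)

text \<open>\<open>P_mat n\<close> is the minor at the last row and first column. Its cofactor
  follows from w M = e_1, and the sign is that of the position.\<close>

lemma det_P_mat:
  "to_fract (det (P_mat n)) = (- 1) ^ (NN n - 1) * W.corner n * to_fract (det (M_mat n))"
proof -
  have "1 * cofactor (map_mat to_fract (M_mat n)) (NN n - 1) 0 =
      W.weight (pair_at (Suc (NN n - 1))) * det (map_mat to_fract (M_mat n))"
    using M_mat_carrier[of n] NN_pos[of n] sum_weight_M_mat
    by (intro cofactor_from_row_combination[where N = "NN n"]) auto
  then have "to_fract (cofactor (M_mat n) (NN n - 1) 0) = W.corner n * to_fract (det (M_mat n))"
    using NN_pos[of n] pair_at_NN[of n] weight_corner[of n]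
    by (simp add: to_fract_hom.hom_cofactor[OF M_mat_carrier])
  moreover have "to_fract (det (P_mat n)) =
      (- 1) ^ (NN n - 1) * to_fract (cofactor (M_mat n) (NN n - 1) 0)"
    by (simp add: P_mat_def cofactor_def to_fract_hom.hom_power)
  ultimately show ?thesis
    by (simp only: mult.assoc)
qed

lemma det_P_mat_nonzero: "to_fract (det (P_mat n)) \<noteq> 0"
  unfolding det_P_mat by (intro no_zero_divisors power_not_zero det_M_mat_nonzero corner_nonzero) simp

section \<open>Replacing the last column of P_n\<close>

text \<open>The truncated w maps \<open>P_mat n\<close> to a multiple of the last unit row, which
  yields the cofactors of the last column; expanding the replaced column along them produces
  \<open>W.border n k\<close>.\<close>

lemma det_P_rep:
  assumes "1 \<le> n" "1 \<le> k" "k \<le> n + 2"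
  shows "W.corner n * to_fract (det (P_rep n k)) = - W.border n k * to_fract (det (P_mat n))"
proof -
  define N where "N = NN n - 1"
  have NN: "NN n = Suc N"
    using NN_pos[of n] by (simp add: N_def)
  \<comment> \<open>Here \<open>n \<ge> 1\<close> gives \<open>NN n \<ge> 3\<close>, so P_n does
    have a rightmost column.\<close>
  have "0 < N"
    using \<open>1 \<le> n\<close> triangle_mono[of 3 "n + 2"] by (simp add: N_def NN_def mult.commute)
  have P: "P_mat n \<in> carrier_mat N N"
    using mat_delete_carrier[OF M_mat_carrier[of n]] by (simp add: P_mat_def N_def)
  have P_entry: "P_mat n $$ (r, c) = M_mat n $$ (r, Suc c)" if "r < N" "c < N" for r c
    using that M_mat_carrier[of n] by (simp add: P_mat_def mat_delete_def NN)
  let ?w = "\<lambda>r. W.weight (pair_at (Suc r))"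
  \<comment> \<open>Row (n+1, n+1) of M_n has the single nonzero entry 1, since [0] = 0. Deleting
    the first column moves it to index N - 1.\<close>
  have last: "M_mat n $$ (N, Suc c) = (if c = N - 1 then 1 else 0)" if "c < N" for c
  proof (cases "c = N - 1")
    case True
    then show ?thesis
      using \<open>0 < N\<close> pair_at_NN[of n] by (simp add: M_mat_def NN M_entry_def)
  next
    case False
    then show ?thesis
      using that M_mat_upper[of "Suc c" N n] by (simp add: NN)
  qed
  have w_last: "?w N = W.corner n"
    using pair_at_NN[of n] weight_corner[of n] by (simp add: NN)
  \<comment> \<open>The term of the deleted last row moves to the other side of w M = e_1.\<close>
  have comb: "(\<Sum>r<N. ?w r * map_mat to_fract (P_mat n) $$ (r, c)) =
      (if c = N - 1 then - W.corner n else 0)" if "c < N" for c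
  proof -
    have "(\<Sum>r<N. ?w r * to_fract (M_mat n $$ (r, Suc c))) + ?w N * to_fract (M_mat n $$ (N, Suc c)) = 0"
      using sum_weight_M_mat[of "Suc c" n] that by (simp add: NN)
    moreover have "(\<Sum>r<N. ?w r * map_mat to_fract (P_mat n) $$ (r, c)) =
        (\<Sum>r<N. ?w r * to_fract (M_mat n $$ (r, Suc c)))"
      using P that by (intro sum.cong) (auto simp: P_entry)
    ultimately show ?thesis
      unfolding last[OF that] w_last
      by (cases "c = N - 1") (simp_all add: eq_neg_iff_add_eq_0)
  qed
  have cof: "- W.corner n * to_fract (cofactor (P_mat n) r (N - 1)) = ?w r * to_fract (det (P_mat n))"
    if "r < N" for r
    using cofactor_from_row_combination[OF _ that _ comb] that P
    by (simp add: to_fract_hom.hom_cofactor[OF P])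
  have bar: "to_fract (col (P_bar n) (k - 1) $ r) = W.entry (pair_at (Suc r)) (n + 2, k)"
    if "r < N" for r
  proof -
    have "pair_at (NN n + k) = (n + 2, k)"
      using pair_at_pair_pos[of k "n + 2"] assms pair_pos_Suc_le[of k n] by simp
    then show ?thesis
      using that assms NN_Suc[of n] by (simp add: P_bar_def M_mat_def to_fract_M_entry NN)
  qed
  have rep: "det (P_rep n k) = (\<Sum>r<N. col (P_bar n) (k - 1) $ r * cofactor (P_mat n) r (N - 1))"
    using P \<open>0 < N\<close> by (simp add: P_rep_def det_replace_col[OF P])
  have "- W.corner n * to_fract (det (P_rep n k)) =
      (\<Sum>r<N. W.entry (pair_at (Suc r)) (n + 2, k) *
        (- W.corner n * to_fract (cofactor (P_mat n) r (N - 1))))"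
    unfolding rep to_fract_hom.hom_sum sum_distrib_left
    by (intro sum.cong refl) (simp only: to_fract_mult bar lessThan_iff ac_simps)
  also have "\<dots> = (\<Sum>r<N. ?w r * W.entry (pair_at (Suc r)) (n + 2, k)) * to_fract (det (P_mat n))"
    unfolding sum_distrib_right by (intro sum.cong refl) (simp only: cof lessThan_iff, simp only: ac_simps)
  also have "(\<Sum>r<N. ?w r * W.entry (pair_at (Suc r)) (n + 2, k)) = W.border n k"
    unfolding W.border_def N_def by (rule sum_pair_at_butlast)
  finally have "- (- W.corner n * to_fract (det (P_rep n k))) =
      - (W.border n k * to_fract (det (P_mat n)))"
    by (rule arg_cong)
  then show ?thesis
    by simp
qed

section \<open>Quotients of determinants\<close>

lemma pairs_Suc: "pairs (Suc n) = pairs n \<union> (\<lambda>i. (n + 2, Suc i)) ` {..Suc n}"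
proof -
  have "(i, j) \<in> (\<lambda>i. (n + 2, Suc i)) ` {..Suc n}" if "i = n + 2" "1 \<le> j" "j \<le> i" for i j
    using that by (intro image_eqI[of _ _ "j - 1"]) auto
  then show ?thesis
    by (auto simp: pairs_def le_Suc_eq)
qed

text \<open>The new factors are the diagonal entries of block n+2. The last of them is 1 because [0]
  = 0; the first is kept apart, as it cancels the denominator in
  \<open>W.corner (Suc n)\<close>.\<close>

lemma det_M_mat_Suc:
  fixes a x y :: "zpoly5 fract"
  defines "a \<equiv> to_fract var_a" and "x \<equiv> to_fract var_x" and "y \<equiv> to_fract var_y"
  shows "to_fract (det (M_mat (Suc n))) = to_fract (det (M_mat n)) *
    ((1 - a * pq_num (Suc n) x y) * (\<Prod>i = 1..n. 1 - a * x ^ i * pq_num (Suc n - i) x y))"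
proof -
  let ?f = "\<lambda>i. 1 - a * x ^ i * pq_num (Suc n - i) x y"
  have "to_fract (det (M_mat (Suc n))) =
      to_fract (det (M_mat n)) * (\<Prod>p\<in>(\<lambda>i. (n + 2, Suc i)) ` {..Suc n}. W.entry p p)"
    unfolding det_M_mat pairs_Suc
    by (rule prod.union_disjoint) (use finite_pairs in \<open>auto simp: pairs_def\<close>)
  also have "(\<Prod>p\<in>(\<lambda>i. (n + 2, Suc i)) ` {..Suc n}. W.entry p p) = (\<Prod>i\<le>Suc n. ?f i)"
    by (subst prod.reindex) (auto simp: inj_on_def W.entry_def a_def x_def y_def intro!: prod.cong)
  also have "{..Suc n} = insert 0 (insert (Suc n) {1..n})"
    by auto
  also have "(\<Prod>i\<in>\<dots>. ?f i) = ?f 0 * (\<Prod>i = 1..n. ?f i)"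
    by (subst prod.insert; simp)+
  finally show ?thesis
    by simp
qed

lemma det_P_mat_ratio:
  fixes a x y t u :: "zpoly5 fract"
  defines "a \<equiv> to_fract var_a" and "x \<equiv> to_fract var_x" and "y \<equiv> to_fract var_y"
    and "t \<equiv> to_fract var_t" and "u \<equiv> to_fract var_u"
  shows "to_fract (det (P_mat (Suc n))) / to_fract (det (P_mat n)) =
    (- 1) ^ n * a * x ^ n * pq_num (Suc n) t u *
      (\<Prod>i = 1..n. 1 - a * x ^ i * pq_num (Suc n - i) x y)"
proof -
  let ?d = "1 - a * pq_num (Suc n) x y" and ?Q = "\<Prod>i = 1..n. 1 - a * x ^ i * pq_num (Suc n - i) x y"
  have "?d \<noteq> 0"
    using W.diag_nonzero[of 0 "Suc n"] by (simp add: a_def x_def y_def)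
  \<comment> \<open>The order grows by n + 2, which has the parity of n.\<close>
  have sign: "(- 1 :: zpoly5 fract) ^ (NN (Suc n) - 1) = (- 1) ^ (NN n - 1) * (- 1) ^ n"
  proof -
    have "NN (Suc n) - 1 = (NN n - 1) + n + 2"
      using NN_pos[of n] by (simp add: NN_Suc)
    then show ?thesis
      by (simp add: power_add)
  qed
  have corner: "W.corner (Suc n) = W.corner n * (a * pq_num (Suc n) t u * x ^ n / ?d)"
    by (simp add: a_def x_def y_def t_def u_def)
  have "to_fract (det (P_mat (Suc n))) =
      (- 1) ^ n * (a * pq_num (Suc n) t u * x ^ n / ?d) * (?d * ?Q) * to_fract (det (P_mat n))"
    unfolding det_P_mat det_M_mat_Suc sign corner a_def x_def y_def by (simp only: ac_simps)
  also have "\<dots> = (- 1) ^ n * a * x ^ n * pq_num (Suc n) t u * ?Q * to_fract (det (P_mat n))"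
    using \<open>?d \<noteq> 0\<close> by simp
  finally show ?thesis
    using det_P_mat_nonzero[of n] by simp
qed

text \<open>The nonzero values of \<open>W.border\<close> have the form -b C_n c, so C_n cancels in
  \<open>det_P_rep\<close>.\<close>

lemma det_P_rep_ratio:
  assumes "1 \<le> n" "1 \<le> k" "k \<le> n + 2" "W.border n k = - b * W.corner n * c"
  shows "to_fract (det (P_rep n k)) / to_fract (det (P_mat n)) = b * c"
proof -
  have "W.corner n * to_fract (det (P_rep n k)) = W.corner n * (b * c * to_fract (det (P_mat n)))"
    unfolding det_P_rep[OF assms(1-3)] assms(4) by simp
  then have "to_fract (det (P_rep n k)) = b * c * to_fract (det (P_mat n))"
    using corner_nonzero[of n] by (simp only: mult_cancel_left simp_thms)
  then show ?thesis
    using det_P_mat_nonzero[of n] by simp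
qed

theorem theorem3p12:
  fixes n :: nat and a x y t u :: "zpoly5 fract"
  defines "a \<equiv> to_fract var_a" and "x \<equiv> to_fract var_x" and "y \<equiv> to_fract var_y"
    and "t \<equiv> to_fract var_t" and "u \<equiv> to_fract var_u"
  assumes "n \<ge> 1"
  shows "to_fract (det (P_mat n)) / to_fract (det (P_mat (n - 1))) =
           (- 1) ^ (n - 1) * a * x ^ (n - 1) * pq_num n t u *
             (\<Prod>i = 1..n - 1. 1 - a * x ^ i * pq_num (n - i) x y) \<and>
         (\<forall>k. 1 \<le> k \<and> k \<le> n \<longrightarrow>
           to_fract (det (P_rep n k)) / to_fract (det (P_mat n)) =
             a * x powi ((int k - 1) * (int k - 2) div 2 - int n * (int n - 1) div 2) *
               y ^ ((n + 1 - k) * (n + 2 - k) div 2) *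
               pq_num (n + 1) t u * pq_binomial (n + 1) (k - 1) x y) \<and>
         to_fract (det (P_rep n (n + 1))) / to_fract (det (P_mat n)) =
           a * y * pq_num (n + 1) t u * pq_num n x y \<and>
         det (P_rep n (n + 2)) = 0"
proof (intro conjI allI impI)
  obtain m where "n = Suc m"
    using \<open>n \<ge> 1\<close> by (cases n) auto
  then show "to_fract (det (P_mat n)) / to_fract (det (P_mat (n - 1))) =
      (- 1) ^ (n - 1) * a * x ^ (n - 1) * pq_num n t u *
        (\<Prod>i = 1..n - 1. 1 - a * x ^ i * pq_num (n - i) x y)"
    using det_P_mat_ratio[of m] by (simp add: a_def x_def y_def t_def u_def)
next
  fix k
  assume k: "1 \<le> k \<and> k \<le> n"
  \<comment> \<open>The exponent of x can be negative and is therefore an integer expression; both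
    of its halves are binomial coefficients, and the power splits into a quotient.\<close>
  have choose_int: "int (j choose 2) = int j * (int j - 1) div 2" for j
    by (cases j) (simp_all add: choose_two zdiv_int algebra_simps)
  have "x \<noteq> 0"
    using W.x_nonzero by (simp add: x_def)
  then have "x powi (int ((k - 1) choose 2) - int (n choose 2)) =
      x ^ ((k - 1) choose 2) / x ^ (n choose 2)"
    by (simp add: power_int_diff)
  moreover have "int (k - 1) = int k - 1" "int k - 1 - 1 = int k - 2"
    using k by simp_all
  ultimately have "x powi ((int k - 1) * (int k - 2) div 2 - int n * (int n - 1) div 2) =
      x ^ ((k - 1) choose 2) / x ^ (n choose 2)"
    by (simp only: choose_int)
  moreover have "(n + 1 - k) * (n + 2 - k) div 2 = (n + 2 - k) choose 2"
    using k by (simp add: choose_two mult.commute)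
  moreover have "to_fract (det (P_rep n k)) / to_fract (det (P_mat n)) = (a * pq_num (n + 1) t u) *
      (x ^ ((k - 1) choose 2) / x ^ (n choose 2) * y ^ ((n + 2 - k) choose 2) *
        pq_binomial (n + 1) (k - 1) x y)"
    using k \<open>n \<ge> 1\<close> W.border_le[of k n]
    by (intro det_P_rep_ratio) (simp_all add: a_def x_def y_def t_def u_def)
  ultimately show "to_fract (det (P_rep n k)) / to_fract (det (P_mat n)) =
      a * x powi ((int k - 1) * (int k - 2) div 2 - int n * (int n - 1) div 2) *
        y ^ ((n + 1 - k) * (n + 2 - k) div 2) * pq_num (n + 1) t u * pq_binomial (n + 1) (k - 1) x y"
    by (simp only: ac_simps)
next
  have "to_fract (det (P_rep n (n + 1))) / to_fract (det (P_mat n)) =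
      (a * pq_num (n + 1) t u) * (y * pq_num n x y)"
    using \<open>n \<ge> 1\<close> W.border_Suc[of n]
    by (intro det_P_rep_ratio) (simp_all add: a_def x_def y_def t_def u_def)
  then show "to_fract (det (P_rep n (n + 1))) / to_fract (det (P_mat n)) =
      a * y * pq_num (n + 1) t u * pq_num n x y"
    by (simp only: ac_simps)
next
  \<comment> \<open>As \<open>W.corner n\<close> is nonzero and \<open>to_fract\<close> injective,
    the determinant vanishes in the polynomial ring itself.\<close>
  have "W.corner n * to_fract (det (P_rep n (n + 2))) = 0"
    using det_P_rep[of n "n + 2"] \<open>n \<ge> 1\<close> W.border_Suc_Suc[of n] by simp
  then show "det (P_rep n (n + 2)) = 0"
    using corner_nonzero[of n] by simp
qed

end
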